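(* Let $\varkappa\in\mathbb{N}$ with $\varkappa>n/2$. Assume that the symbol $\sigma_\hbar:\hbar\mathbb{Z}^n\times\mathbb{T}^n\to\mathbb{C}$, with $\sigma_\hbar(k,\cdot)\in C^\varkappa(\mathbb{T}^n)$ for each $k$, satisfies, for some constant $C$, $$|D^{(\alpha)}_{\hbar,\theta}\sigma_\hbar(k,\theta)|\le C\qquad\text{for all }(k,\theta)\in\hbar\mathbb{Z}^n\times\mathbb{T}^n$$ for all $|\alpha|\le\varkappa$. Then the semi-classical pseudo-differential operator $\mathrm{Op}_\hbar(\sigma_\hbar)$ extends to a bounded operator on $\ell^2(\hbar\mathbb{Z}^n)$.
   Context: Fix $n\ge1$ and $\hbar\in(0,1]$. $\hbar\mathbb{Z}^n=\{\hbar\bar k:\bar k\in\mathbb{Z}^n\}\subset\mathbb{R}^n$, $\mathbb{T}^n=\mathbb{R}^n/\mathbb{Z}^n$ with normalized Haar measure, $k\cdot\theta=\sum_jk_j\theta_j$. Semi-classical Fourier transform: $\widehat f(\theta)=\sum_{k\in\hbar\mathbb{Z}^n}e^{-2\pi\frac{i}{\hbar}k\cdot\theta}f(k)$. Quantization: $\mathrm{Op}_\hbar(\sigma_\hbar)f(k)=\int_{\mathbb{T}^n}e^{2\pi\frac{i}{\hbar}k\cdot\theta}\sigma_\hbar(k,\theta)\widehat f(\theta)\,d\theta$. Toroidal operators: for $\alpha\in\mathbb{N}_0^n$, $D_{\hbar,\theta}^{(\alpha)}=\hbar^{|\alpha|}\prod_{j=1}^n\prod_{\ell=0}^{\alpha_j-1}\big(\frac{1}{2\pi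 i}\frac{\partial}{\partial\theta_j}-\ell\big)$. *)

theory Defs
  imports "HOL-Analysis.Analysis"
begin

text \<open>
  Points of \<open>h \<int>\<^sup>n\<close> are elements of \<open>real ^ 'n\<close> with \<open>n = CARD('n)\<close>. Functions on
  the torus \<open>\<real>\<^sup>n / \<int>\<^sup>n\<close> are identified with \<open>\<int>\<^sup>n\<close>-periodic functions on \<open>real ^ 'n\<close>;
  the integral for normalized Haar measure is then the Lebesgue integral over the
  unit cube \<open>[0,1]\<^sup>n\<close>.
\<close>

definition int_lattice :: "(real ^ 'n) set" where
  "int_lattice = {x. \<forall>j. x $ j \<in> \<int>}"

definition scaled_lattice :: "real \<Rightarrow> (real ^ 'n) set" where
  "scaled_lattice h = (\<lambda>x. h *\<^sub>R x) ` int_lattice"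

definition periodic :: "(real ^ 'n \<Rightarrow> complex) \<Rightarrow> bool" where
  "periodic g \<longleftrightarrow> (\<forall>m \<in> int_lattice. \<forall>\<theta>. g (\<theta> + m) = g \<theta>)"

definition partial :: "'n \<Rightarrow> (real ^ 'n \<Rightarrow> complex) \<Rightarrow> real ^ 'n \<Rightarrow> complex" where
  "partial j g \<theta> = vector_derivative (\<lambda>t. g (\<theta> + t *\<^sub>R axis j 1)) (at 0)"

primrec Ck :: "nat \<Rightarrow> (real ^ 'n \<Rightarrow> complex) \<Rightarrow> bool" where
  "Ck 0 g \<longleftrightarrow> continuous_on UNIV g"
| "Ck (Suc m) g \<longleftrightarrow> g differentiable_on UNIV \<and> (\<forall>j. Ck m (partial j g))"

definition torus_Ck :: "nat \<Rightarrow> (real ^ 'n \<Rightarrow> complex) \<Rightarrow> bool" where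
  "torus_Ck m g \<longleftrightarrow> periodic g \<and> Ck m g"

definition torus_integral :: "(real ^ 'n \<Rightarrow> complex) \<Rightarrow> complex" where
  "torus_integral g = set_lebesgue_integral lborel (cbox 0 1) g"

definition mi_order :: "nat ^ 'n \<Rightarrow> nat" where
  "mi_order \<alpha> = (\<Sum>j\<in>UNIV. \<alpha> $ j)"

definition toroidal_factor ::
  "'n \<Rightarrow> nat \<Rightarrow> (real ^ 'n \<Rightarrow> complex) \<Rightarrow> real ^ 'n \<Rightarrow> complex" where
  "toroidal_factor j l g \<theta> = 1 / (2 * of_real pi * \<i>) * partial j g \<theta> - of_nat l * g \<theta>"

text \<open>
  The product of the first-order factors is their composition. The linear order on
  \<open>'n\<close> plays the role of the order on \<open>{1, \<dots>, n}\<close> and fixes the order of the factors.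
\<close>

definition toroidal_D ::
  "real \<Rightarrow> (nat, 'n::{finite,linorder}) vec \<Rightarrow>
   ((real, 'n) vec \<Rightarrow> complex) \<Rightarrow> (real, 'n) vec \<Rightarrow> complex" where
  "toroidal_D h \<alpha> g \<theta> =
     of_real (h ^ mi_order \<alpha>) *
     foldr (\<circ>)
       [toroidal_factor j l. j \<leftarrow> sorted_list_of_set UNIV, l \<leftarrow> [0..<\<alpha> $ j]] id g \<theta>"

text \<open>A function on a set \<open>X\<close> is represented by its extension by \<open>0\<close> outside \<open>X\<close>.\<close>

definition l1_on :: "'a set \<Rightarrow> ('a \<Rightarrow> complex) set" where
  "l1_on X = {f. (\<forall>x. x \<notin> X \<longrightarrow> f x = 0) \<and> (\<lambda>x. norm (f x)) summable_on X}"

definition l2_on :: "'a set \<Rightarrow> ('a \<Rightarrow> complex) set" where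
  "l2_on X = {f. (\<forall>x. x \<notin> X \<longrightarrow> f x = 0) \<and> (\<lambda>x. (norm (f x))\<^sup>2) summable_on X}"

definition l2_norm :: "'a set \<Rightarrow> ('a \<Rightarrow> complex) \<Rightarrow> real" where
  "l2_norm X f = sqrt (\<Sum>\<^sub>\<infinity>x\<in>X. (norm (f x))\<^sup>2)"

definition bounded_op_l2 :: "'a set \<Rightarrow> (('a \<Rightarrow> complex) \<Rightarrow> ('a \<Rightarrow> complex)) \<Rightarrow> bool" where
  "bounded_op_l2 X T \<longleftrightarrow>
     (\<forall>f \<in> l2_on X. T f \<in> l2_on X) \<and>
     (\<forall>f \<in> l2_on X. \<forall>g \<in> l2_on X. T (\<lambda>x. f x + g x) = (\<lambda>x. T f x + T g x)) \<and>
     (\<forall>c. \<forall>f \<in> l2_on X. T (\<lambda>x. c * f x) = (\<lambda>x. c * T f x)) \<and>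
     (\<exists>B. \<forall>f \<in> l2_on X. l2_norm X (T f) \<le> B * l2_norm X f)"

definition sc_fourier :: "real \<Rightarrow> (real ^ 'n \<Rightarrow> complex) \<Rightarrow> real ^ 'n \<Rightarrow> complex" where
  "sc_fourier h f \<theta> =
     (\<Sum>\<^sub>\<infinity>k \<in> scaled_lattice h.
        exp (- 2 * of_real pi * (\<i> / of_real h) * of_real (k \<bullet> \<theta>)) * f k)"

definition Op ::
  "real \<Rightarrow> (real ^ 'n \<Rightarrow> real ^ 'n \<Rightarrow> complex) \<Rightarrow>
   (real ^ 'n \<Rightarrow> complex) \<Rightarrow> real ^ 'n \<Rightarrow> complex" where
  "Op h \<sigma> f k =
     torus_integral (\<lambda>\<theta>.
       exp (2 * of_real pi * (\<i> / of_real h) * of_real (k \<bullet> \<theta>)) * \<sigma> k \<theta> * sc_fourier h f \<theta>)"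

text \<open>
  The initial domain of \<open>Op h \<sigma>\<close> is \<open>\<ell>\<^sup>1\<close>, the functions for which the series defining the
  Fourier transform converges absolutely. It contains all rapidly decreasing functions
  and is dense in \<open>\<ell>\<^sup>2\<close>, so a bounded extension is unique.
\<close>

definition extends_to_bounded_op_l2 ::
  "real \<Rightarrow> (real ^ 'n \<Rightarrow> real ^ 'n \<Rightarrow> complex) \<Rightarrow> bool" where
  "extends_to_bounded_op_l2 h \<sigma> \<longleftrightarrow>
     (\<exists>T. bounded_op_l2 (scaled_lattice h) T \<and>
          (\<forall>f \<in> l1_on (scaled_lattice h). \<forall>k \<in> scaled_lattice h. T f k = Op h \<sigma> f k))"

end

theory Submission
  imports Defs
begin

text \<open>
  On lattice points the operator has the kernel \<open>K(k, l) = c\<^sub>k((k - l)/h)\<close>, where \<open>c\<^sub>k\<close> are the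
  Fourier coefficients of \<open>\<sigma> k\<close>. The operator \<open>D\<^sup>\<alpha>\<close> with \<open>\<alpha> = \<kappa> e\<^sub>j\<close> multiplies \<open>c\<^sub>k(m)\<close> by
  \<open>\<plusminus> h\<^sup>\<kappa> \<Prod>\<^sub>l (m\<^sub>j + l)\<close>, so Bessel's inequality bounds \<open>\<Sum>\<^sub>m w(m) \<bar>c\<^sub>k(m)\<bar>\<^sup>2\<close> uniformly in \<open>k\<close> for the weight
  \<open>w(m) = 1 + \<Sum>\<^sub>j \<bar>\<Prod>\<^sub>l (m\<^sub>j + l)\<bar>\<^sup>2\<close>. Since \<open>2 \<kappa> > n\<close>, the function \<open>1/w\<close> is summable over \<open>\<int>\<^sup>n\<close>.
  Cauchy-Schwarz gives \<open>\<bar>T f(k)\<bar>\<^sup>2 \<le> B \<Sum>\<^sub>l \<bar>f(l)\<bar>\<^sup>2 / w((k - l)/h)\<close>, and summing over \<open>k\<close> bounds \<open>T\<close>.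
\<close>

section \<open>Fourier coefficients on the torus\<close>

abbreviation unit_cube :: "(real ^ 'n) set" where
  "unit_cube \<equiv> cbox 0 1"

text \<open>Passing to the gauge integral gives access to the fundamental theorem of calculus, the
  swap of iterated integrals and the uniform limit theorem used below.\<close>

lemma torus_integral_eq_integral:
  assumes "continuous_on unit_cube g"
  shows "torus_integral g = integral unit_cube g"
  unfolding torus_integral_def
  by (rule set_borel_integral_eq_integral(2))
    (use borel_integrable_compact[OF compact_cbox assms] in \<open>simp add: set_integrable_def\<close>)

lemma axis_in_int_lattice: "axis j 1 \<in> int_lattice"
  by (auto simp: int_lattice_def axis_def)

text \<open>Translation moves the cube; the slab that then sticks out beyond coordinate 1 is carried
  back by the period \<open>axis j 1\<close> into the gap left at 0. For \<open>0 \<le> s\<close>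
  and \<open>s \<le> 1\<close> a single slab suffices.\<close>

lemma integral_periodic_translate:
  assumes per: "periodic (g :: real ^ 'n \<Rightarrow> complex)" and cont: "continuous_on UNIV g"
    and s: "0 \<le> s" "s \<le> 1"
  shows "integral unit_cube (\<lambda>\<theta>. g (\<theta> + s *\<^sub>R axis j 1)) = integral unit_cube g"
proof -
  define e where "e = (axis j 1 :: real ^ 'n)"
  have e: "e \<in> Basis" by (simp add: e_def)
  have ej: "x \<bullet> e = x $ j" for x by (simp add: e_def inner_axis)
  have e_nth: "e $ i = (if i = j then 1 else 0)" for i by (auto simp: e_def axis_def)
  have int: "g integrable_on cbox a b" for a b
    by (rule integrable_continuous) (use cont continuous_on_subset in blast)
  \<comment> \<open>\<open>B u v\<close> is the unit cube with its side in direction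
    \<open>j\<close> replaced by \<open>[u, 1 + v]\<close>: \<open>B s s\<close> is the translated
    cube and \<open>B 1 s\<close> the protruding slab, a translate by \<open>e\<close> of
    \<open>B 0 (s - 1)\<close>.\<close>
  define B where "B u v = cbox (u *\<^sub>R e) (1 + v *\<^sub>R e)" for u v
  have B: "x \<in> B u v \<longleftrightarrow> u \<le> x $ j \<and> x $ j \<le> 1 + v \<and> (\<forall>i. i \<noteq> j \<longrightarrow> 0 \<le> x $ i \<and> x $ i \<le> 1)" for x u v
    by (auto simp: B_def mem_box_cart e_nth)
  have B0: "unit_cube = B 0 0" by (simp add: B_def)
  have "integral unit_cube (\<lambda>\<theta>. g (\<theta> + s *\<^sub>R e)) = integral (B s s) g"
    using integral_shift_cbox_plus[of 0 1 g "s *\<^sub>R e"] by (simp add: B_def o_def add.commute)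
  also have "\<dots> = integral (B s s \<inter> {x. x \<bullet> e \<le> 1}) g + integral (B s s \<inter> {x. x \<bullet> e \<ge> 1}) g"
    unfolding B_def by (rule integral_split[OF int e])
  also have "B s s \<inter> {x. x \<bullet> e \<le> 1} = B 0 0 \<inter> {x. x \<bullet> e \<ge> s}"
    using s by (intro set_eqI) (auto simp: B ej)
  also have "B s s \<inter> {x. x \<bullet> e \<ge> 1} = B 1 s"
    using s by (intro set_eqI) (auto simp: B ej)
  also have "B 1 s = cbox (0 + e) (1 + (s - 1) *\<^sub>R e + e)"
    by (simp add: B_def algebra_simps)
  also have "integral \<dots> g = integral (B 0 (s - 1)) (g \<circ> (+) e)"
    unfolding B_def using integral_shift_cbox_plus[of 0 "1 + (s - 1) *\<^sub>R e" g e] by simp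
  also have "g \<circ> (+) e = g"
    using per axis_in_int_lattice[of j] by (auto simp: periodic_def e_def fun_eq_iff add.commute)
  also have "B 0 (s - 1) = B 0 0 \<inter> {x. x \<bullet> e \<le> s}"
    using s by (intro set_eqI) (auto simp: B ej)
  also have "integral (B 0 0 \<inter> {x. x \<bullet> e \<ge> s}) g + integral (B 0 0 \<inter> {x. x \<bullet> e \<le> s}) g
      = integral unit_cube g"
    unfolding B0 B_def by (subst integral_split[OF int e, of _ _ s]) simp
  finally show ?thesis by (simp add: e_def)
qed

text \<open>\<open>partial\<close> differentiates at parameter 0 only. Moving the base point along
  the line gives the derivative at every \<open>t\<close>, as the fundamental theorem of calculus
  requires.\<close>

lemma partial_has_vector_derivative:
  assumes "g differentiable_on UNIV"
  shows "((\<lambda>t. g (\<theta> + t *\<^sub>R axis j 1)) has_vector_derivative partial j g (\<theta> + t *\<^sub>R axis j 1)) (at t)"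
proof -
  have diff: "(\<lambda>t. g (\<theta> + t *\<^sub>R axis j 1)) differentiable (at s)" for s \<theta>
  proof -
    have "(\<lambda>t. \<theta> + t *\<^sub>R axis j 1) differentiable (at s)"
      by simp
    moreover have "g differentiable (at (\<theta> + s *\<^sub>R axis j 1))"
      using assms by (auto simp: differentiable_on_def)
    ultimately show ?thesis using differentiable_chain_at[of "\<lambda>t. \<theta> + t *\<^sub>R axis j 1" s g] by (simp add: o_def)
  qed
  have "((\<lambda>u. g ((\<theta> + t *\<^sub>R axis j 1) + u *\<^sub>R axis j 1)) has_vector_derivative partial j g (\<theta> + t *\<^sub>R axis j 1)) (at 0)"
    unfolding partial_def using diff vector_derivative_works by blast
  then have "(((\<lambda>u. g ((\<theta> + t *\<^sub>R axis j 1) + u *\<^sub>R axis j 1)) \<circ> (\<lambda>u. u - t)) has_vector_derivative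
      1 *\<^sub>R partial j g (\<theta> + t *\<^sub>R axis j 1)) (at t)"
    by (intro vector_diff_chain_at) (auto intro!: derivative_eq_intros)
  then show ?thesis by (simp add: o_def algebra_simps)
qed

lemma partial_eqI:
  assumes "((\<lambda>t. g (\<theta> + t *\<^sub>R axis j 1)) has_vector_derivative D) (at 0)"
  shows "partial j g \<theta> = D"
  unfolding partial_def by (rule vector_derivative_at[OF assms])

lemma partial_at:
  assumes "g differentiable_on UNIV"
  shows "((\<lambda>t. g (\<theta> + t *\<^sub>R axis j 1)) has_vector_derivative partial j g \<theta>) (at 0)"
  using partial_has_vector_derivative[OF assms, of \<theta> j 0] by simp

text \<open>
  Averaging over translates in direction \<open>j\<close> leaves the integral of \<open>partial j g\<close> unchanged, and
  by Fubini it becomes the integral of \<open>g (\<theta> + e\<^sub>j) - g \<theta> = 0\<close>.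
\<close>

lemma integral_partial_periodic:
  assumes per: "periodic g" and diff: "g differentiable_on UNIV"
    and cont: "continuous_on UNIV (partial j g)" and perp: "periodic (partial j g)"
  shows "integral unit_cube (partial j g) = 0"
proof -
  have contj: "continuous_on S (\<lambda>(\<theta>, t). partial j g (\<theta> + t *\<^sub>R axis j 1))" for S
    unfolding case_prod_beta
    by (rule continuous_on_compose2[OF cont]) (auto intro!: continuous_intros)
  have "integral unit_cube (partial j g)
      = integral (cbox 0 (1::real)) (\<lambda>t. integral unit_cube (partial j g))"
    by simp
  also have "\<dots> = integral (cbox 0 1) (\<lambda>t. integral unit_cube (\<lambda>\<theta>. partial j g (\<theta> + t *\<^sub>R axis j 1)))"
    by (intro integral_cong integral_periodic_translate[symmetric] perp cont) auto
  also have "\<dots> = integral unit_cube (\<lambda>\<theta>. integral (cbox 0 1) (\<lambda>t. partial j g (\<theta> + t *\<^sub>R axis j 1)))"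
    by (rule integral_swap_continuous[symmetric, OF contj])
  also have "\<dots> = integral unit_cube (\<lambda>\<theta>::real^'a. 0)"
  proof (rule integral_cong)
    fix \<theta> :: "real ^ 'a"
    have "((\<lambda>t. partial j g (\<theta> + t *\<^sub>R axis j 1)) has_integral
        (g (\<theta> + 1 *\<^sub>R axis j 1) - g (\<theta> + 0 *\<^sub>R axis j 1))) {0..1}"
      by (rule fundamental_theorem_of_calculus)
        (auto intro!: has_vector_derivative_at_within partial_has_vector_derivative diff)
    moreover have "g (\<theta> + 1 *\<^sub>R axis j 1) = g \<theta>"
      using per axis_in_int_lattice[of j] by (simp add: periodic_def)
    ultimately show "integral (cbox 0 1) (\<lambda>t. partial j g (\<theta> + t *\<^sub>R axis j 1)) = 0"
      by (simp add: integral_unique)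
  qed
  finally show ?thesis by simp
qed

section \<open>Smoothness and periodicity under toroidal factors\<close>

lemma periodic_partial: "periodic g \<Longrightarrow> periodic (partial j g)"
  unfolding periodic_def partial_def
  by (simp add: add.assoc add.commute[of _ "_ *\<^sub>R _"]) (simp flip: add.assoc)

lemma Ck_continuous: "Ck m g \<Longrightarrow> continuous_on UNIV g"
  by (cases m) (simp_all add: differentiable_imp_continuous_on)

lemma Ck_Suc_imp_Ck: "Ck (Suc m) g \<Longrightarrow> Ck m g"
proof (induction m arbitrary: g)
  case 0
  then show ?case by (simp add: differentiable_imp_continuous_on)
next
  case (Suc m)
  then show ?case by (metis Ck.simps(2))
qed

lemma Ck_lincomb:
  "Ck m f \<Longrightarrow> Ck m g \<Longrightarrow> Ck m (\<lambda>\<theta>. a * f \<theta> + b * g \<theta>)"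
proof (induction m arbitrary: f g)
  case 0
  then show ?case by (simp add: continuous_intros)
next
  case (Suc m)
  then have df: "f differentiable_on UNIV" "g differentiable_on UNIV" by simp_all
  have "(\<lambda>\<theta>. a * f \<theta> + b * g \<theta>) differentiable_on UNIV"
    using df by (simp add: differentiable_on_def)
  moreover have "partial j (\<lambda>\<theta>. a * f \<theta> + b * g \<theta>) = (\<lambda>\<theta>. a * partial j f \<theta> + b * partial j g \<theta>)" for j
    by (intro ext partial_eqI has_vector_derivative_add has_vector_derivative_mult_right partial_at df)
  ultimately show ?case using Suc by simp
qed

lemma torus_Ck_toroidal_factor:
  assumes "torus_Ck (Suc m) g"
  shows "torus_Ck m (toroidal_factor j l g)"
proof -
  have eq: "toroidal_factor j l g = (\<lambda>\<theta>. (1 / (2 * of_real pi * \<i>)) * partial j g \<theta> + (- of_nat l) * g \<theta>)"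
    by (auto simp: toroidal_factor_def)
  have "Ck m (toroidal_factor j l g)"
    unfolding eq using assms Ck_Suc_imp_Ck[of m g] by (intro Ck_lincomb) (auto simp: torus_Ck_def)
  moreover have "periodic (toroidal_factor j l g)"
    using assms periodic_partial[of g j] by (auto simp: torus_Ck_def periodic_def toroidal_factor_def)
  ultimately show ?thesis by (simp add: torus_Ck_def)
qed

section \<open>Characters and the action of toroidal operators on Fourier coefficients\<close>

lemma Ints_inner_int_lattice:
  assumes "m \<in> int_lattice" "p \<in> int_lattice"
  shows "m \<bullet> p \<in> \<int>"
  unfolding inner_vec_def inner_real_def
  using assms by (auto simp: int_lattice_def intro!: Ints_sum Ints_mult)

definition character :: "real ^ 'n \<Rightarrow> real ^ 'n \<Rightarrow> complex" where
  "character m \<theta> = cis (2 * pi * (m \<bullet> \<theta>))"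

lemma norm_character [simp]: "norm (character m \<theta>) = 1"
  by (simp add: character_def)

lemma cnj_character: "cnj (character m \<theta>) = character (- m) \<theta>"
  by (simp add: character_def cis_cnj)

lemma character_add: "character (m + p) \<theta> = character m \<theta> * character p \<theta>"
  by (simp add: character_def cis_mult inner_add_left algebra_simps)

lemma character_differentiable: "character m differentiable_on UNIV"
  unfolding differentiable_on_def
proof
  fix x
  have "((\<lambda>\<theta>. cis (2 * pi * (m \<bullet> \<theta>))) has_derivative
      (\<lambda>y. (2 * pi * (m \<bullet> y)) *\<^sub>R (\<i> * cis (2 * pi * (m \<bullet> x))))) (at x)"
    by (auto intro!: derivative_eq_intros)
  then show "character m differentiable (at x)"
    unfolding character_def[abs_def] differentiable_def by blast
qed

lemma continuous_on_character [continuous_intros]: "continuous_on S (character m)"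
  using character_differentiable differentiable_imp_continuous_on continuous_on_subset by blast

lemma periodic_character:
  assumes "m \<in> int_lattice"
  shows "periodic (character m)"
  unfolding periodic_def
proof (intro ballI allI)
  fix p \<theta> :: "real ^ 'a" assume "p \<in> int_lattice"
  then have "m \<bullet> p \<in> \<int>" using assms by (rule Ints_inner_int_lattice[rotated])
  then have "cis (2 * pi * (m \<bullet> p)) = 1" by (rule cis_multiple_2pi)
  then show "character m (\<theta> + p) = character m \<theta>"
    by (simp add: character_def inner_add_right distrib_left flip: cis_mult)
qed

lemma partial_character:
  "partial j (character m) \<theta> = 2 * of_real pi * \<i> * of_real (m $ j) * character m \<theta>"
proof (rule partial_eqI)
  have *: "m \<bullet> axis j 1 = m $ j" by (simp add: inner_axis)
  show "((\<lambda>t. character m (\<theta> + t *\<^sub>R axis j 1)) has_vector_derivative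
      2 * of_real pi * \<i> * of_real (m $ j) * character m \<theta>) (at 0)"
    unfolding character_def inner_add_right inner_scaleR_right * has_vector_derivative_def
    by (auto intro!: derivative_eq_intros simp: scaleR_conv_of_real algebra_simps)
qed

text \<open>The sign convention is \<open>e\<^bsup>+2\<pi>i m\<cdot>\<theta>\<^esup>\<close>, so this is the usual coefficient at \<open>-m\<close>.\<close>

definition fourier_coeff :: "(real ^ 'n \<Rightarrow> complex) \<Rightarrow> real ^ 'n \<Rightarrow> complex" where
  "fourier_coeff g m = integral unit_cube (\<lambda>\<theta>. character m \<theta> * g \<theta>)"

text \<open>Integration by parts: the derivative of the periodic product
  \<open>character m \<theta> * g \<theta>\<close> has integral zero, so the derivative moves to the
  character at the price of a sign.\<close>

lemma fourier_coeff_partial: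
  assumes g: "torus_Ck (Suc k) g" and m: "m \<in> int_lattice"
  shows "fourier_coeff (partial j g) m = - (2 * of_real pi * \<i> * of_real (m $ j)) * fourier_coeff g m"
proof -
  let ?c = "2 * of_real pi * \<i> * of_real (m $ j)"
  let ?F = "\<lambda>\<theta>. character m \<theta> * g \<theta>"
  have dg: "g differentiable_on UNIV" and cp: "continuous_on UNIV (partial j g)" and per: "periodic g"
    using g by (auto simp: torus_Ck_def intro: Ck_continuous)
  have cg: "continuous_on UNIV g" using dg by (rule differentiable_imp_continuous_on)
  have pF: "partial j ?F = (\<lambda>\<theta>. character m \<theta> * partial j g \<theta> + ?c * (character m \<theta> * g \<theta>))"
  proof
    fix \<theta>
    have "((\<lambda>t. ?F (\<theta> + t *\<^sub>R axis j 1)) has_vector_derivative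
       character m (\<theta> + 0 *\<^sub>R axis j 1) * partial j g \<theta> + partial j (character m) \<theta> * g (\<theta> + 0 *\<^sub>R axis j 1)) (at 0)"
      by (intro has_vector_derivative_mult partial_at character_differentiable dg)
    then show "partial j ?F \<theta> = character m \<theta> * partial j g \<theta> + ?c * (character m \<theta> * g \<theta>)"
      by (intro partial_eqI) (simp add: partial_character mult.assoc)
  qed
  have "integral unit_cube (partial j ?F) = 0"
  proof (rule integral_partial_periodic)
    show p: "periodic ?F" using per periodic_character[OF m] by (simp add: periodic_def)
    show "?F differentiable_on UNIV"
      using dg character_differentiable by (auto simp: differentiable_on_def intro!: derivative_intros)
    show "continuous_on UNIV (partial j ?F)"
      unfolding pF by (intro continuous_intros cp cg)
    show "periodic (partial j ?F)" using p by (rule periodic_partial)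
  qed
  also have "integral unit_cube (partial j ?F)
      = fourier_coeff (partial j g) m + ?c * fourier_coeff g m"
    unfolding pF fourier_coeff_def integral_mult_right[symmetric]
    by (intro integral_add integrable_continuous continuous_intros
        continuous_on_subset[OF cp] continuous_on_subset[OF cg]) auto
  finally show ?thesis unfolding eq_neg_iff_add_eq_0 mult_minus_left .
qed

text \<open>The prefactor cancels the constant of the derivative and leaves \<open>- m $ j\<close>.
  This sign, due to pairing with \<open>character m\<close>, is why subtracting \<open>l\<close>
  shows up as \<open>m $ j + real l\<close>.\<close>

lemma fourier_coeff_toroidal_factor:
  assumes g: "torus_Ck (Suc k) g" and m: "m \<in> int_lattice"
  shows "fourier_coeff (toroidal_factor j l g) m = - of_real (m $ j + real l) * fourier_coeff g m"
proof -
  let ?a = "1 / (2 * of_real pi * \<i>) :: complex"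
  have cp: "continuous_on unit_cube (partial j g)" and cg: "continuous_on unit_cube g"
    using g Ck_continuous[of k "partial j g"] Ck_continuous[of "Suc k" g]
    by (auto simp: torus_Ck_def intro: continuous_on_subset)
  have "fourier_coeff (toroidal_factor j l g) m =
     integral unit_cube (\<lambda>\<theta>. ?a * (character m \<theta> * partial j g \<theta>) - of_nat l * (character m \<theta> * g \<theta>))"
    unfolding fourier_coeff_def toroidal_factor_def
    by (intro arg_cong2[where f = integral] refl ext) (simp add: algebra_simps)
  also have "\<dots> = ?a * fourier_coeff (partial j g) m - of_nat l * fourier_coeff g m"
    unfolding fourier_coeff_def integral_mult_right[symmetric]
    by (intro integral_diff integrable_continuous continuous_intros cp cg)
  also have "\<dots> = - of_real (m $ j + real l) * fourier_coeff g m"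
    by (simp add: fourier_coeff_partial[OF g m] field_simps)
  finally show ?thesis .
qed

text \<open>\<open>k\<close> is the smoothness left over after all factors. The induction peels off
  the outermost factor, which needs one more derivative of the inner composition; the coefficient
  formula needs it too, so both claims are proved together.\<close>

lemma toroidal_factors:
  assumes "torus_Ck (length xs + k) g"
  shows "torus_Ck k (foldr (\<circ>) (map (\<lambda>(j, l). toroidal_factor j l) xs) id g)" (is ?A)
    and "m \<in> int_lattice \<Longrightarrow>
      fourier_coeff (foldr (\<circ>) (map (\<lambda>(j, l). toroidal_factor j l) xs) id g) m
      = prod_list (map (\<lambda>(j, l). - of_real (m $ j + real l)) xs) * fourier_coeff g m" (is "_ \<Longrightarrow> ?B")
proof -
  have "torus_Ck k (foldr (\<circ>) (map (\<lambda>(j, l). toroidal_factor j l) xs) id g) \<and>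
    (m \<in> int_lattice \<longrightarrow> fourier_coeff (foldr (\<circ>) (map (\<lambda>(j, l). toroidal_factor j l) xs) id g) m
      = prod_list (map (\<lambda>(j, l). - of_real (m $ j + real l)) xs) * fourier_coeff g m)"
    using assms
  proof (induction xs arbitrary: k)
    case (Cons x xs)
    then have "torus_Ck (length xs + Suc k) g" by simp
    note IH = Cons.IH[OF this]
    obtain j l where x: "x = (j, l)" by force
    define G where "G = foldr (\<circ>) (map (\<lambda>(j, l). toroidal_factor j l) xs) id g"
    have G: "torus_Ck (Suc k) G" using IH unfolding G_def by blast
    have eq: "foldr (\<circ>) (map (\<lambda>(j, l). toroidal_factor j l) (x # xs)) id g = toroidal_factor j l G"
      by (simp add: x G_def)
    show ?case
    proof (intro conjI impI, goal_cases)
      case 1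
      show ?case unfolding eq by (rule torus_Ck_toroidal_factor[OF G])
    next
      case 2
      then show ?case
        unfolding eq fourier_coeff_toroidal_factor[OF G 2] using IH unfolding G_def[symmetric] x
        by (simp add: mult.assoc)
    qed
  qed simp
  then show ?A "m \<in> int_lattice \<Longrightarrow> ?B" by auto
qed

text \<open>The nested list of factors is flattened to pairs \<open>(j, l)\<close>. There are
  \<open>mi_order \<alpha>\<close> of them, so the available smoothness is just used up and
  continuity remains.\<close>

lemma fourier_coeff_toroidal_D:
  fixes m :: "real ^ 'n::{finite,linorder}"
  assumes g: "torus_Ck (mi_order \<alpha>) g"
  shows "continuous_on UNIV (toroidal_D h \<alpha> g)"
    and "m \<in> int_lattice \<Longrightarrow> fourier_coeff (toroidal_D h \<alpha> g) m
      = of_real (h ^ mi_order \<alpha>) * (\<Prod>j\<in>UNIV. \<Prod>l<\<alpha> $ j. - of_real (m $ j + real l)) * fourier_coeff g m"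
proof -
  define xs where "xs = concat (map (\<lambda>j. map (Pair j) [0..<\<alpha> $ j]) (sorted_list_of_set (UNIV :: 'n set)))"
  have eq: "concat (map (\<lambda>j. map (toroidal_factor j) [0..<\<alpha> $ j]) (sorted_list_of_set (UNIV :: 'n set)))
      = map (\<lambda>(j, l). toroidal_factor j l) xs"
    by (simp add: xs_def map_concat o_def)
  have D: "toroidal_D h \<alpha> g = (\<lambda>\<theta>. of_real (h ^ mi_order \<alpha>) *
      foldr (\<circ>) (map (\<lambda>(j, l). toroidal_factor j l) xs) id g \<theta>)"
    by (simp add: toroidal_D_def fun_eq_iff flip: eq)
  have "length xs = mi_order \<alpha>"
    by (simp add: xs_def length_concat o_def mi_order_def sum_list_distinct_conv_sum_set)
  with g have Ck: "torus_Ck (length xs + 0) g" by simp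
  show "continuous_on UNIV (toroidal_D h \<alpha> g)"
    using toroidal_factors(1)[OF Ck] unfolding D
    by (auto simp: torus_Ck_def intro!: continuous_intros)
  have "prod_list (map (\<lambda>(j, l). - of_real (m $ j + real l) :: complex) xs)
      = (\<Prod>j\<in>UNIV. \<Prod>l<\<alpha> $ j. - of_real (m $ j + real l))"
  proof -
    \<comment> \<open>Stated for every distinct list of directions so that induction applies;
      distinctness turns the list product into a set product.\<close>
    have "prod_list (map (\<lambda>(j, l). - of_real (m $ j + real l) :: complex) (concat (map (\<lambda>j. map (Pair j) [0..<\<alpha> $ j]) js)))
      = (\<Prod>j\<in>set js. \<Prod>l<\<alpha> $ j. - of_real (m $ j + real l))" if "distinct js" for js
      using that
      by (induction js) (auto simp: o_def prod.distinct_set_conv_list[symmetric] atLeast0LessThan)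
    from this[of "sorted_list_of_set UNIV"] show ?thesis by (simp add: xs_def)
  qed
  then show "fourier_coeff (toroidal_D h \<alpha> g) m
      = of_real (h ^ mi_order \<alpha>) * (\<Prod>j\<in>UNIV. \<Prod>l<\<alpha> $ j. - of_real (m $ j + real l)) * fourier_coeff g m"
    if "m \<in> int_lattice"
    using toroidal_factors(2)[OF Ck that]
    unfolding D fourier_coeff_def by (simp add: mult.left_commute[of "character m _"] mult.assoc)
qed

section \<open>Orthonormality of the characters and Bessel's inequality\<close>

lemma content_unit_cube: "measure lborel (unit_cube :: (real ^ 'n) set) = 1"
proof -
  have "(0 :: real ^ 'n) \<in> unit_cube" by (simp add: mem_box_cart)
  then show ?thesis by (subst content_cbox_cart) auto
qed

text \<open>For \<open>m \<noteq> 0\<close> the character is a constant multiple of one of its own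
  partial derivatives, and these integrate to zero by periodicity.\<close>

lemma integral_character:
  assumes "m \<in> int_lattice"
  shows "integral unit_cube (character m) = (if m = 0 then 1 else 0)"
proof (cases "m = 0")
  case True
  then show ?thesis by (simp add: character_def[abs_def] content_unit_cube)
next
  case False
  then obtain j where j: "m $ j \<noteq> 0" by (auto simp: vec_eq_iff)
  have p: "partial j (character m) = (\<lambda>\<theta>. (2 * of_real pi * \<i> * of_real (m $ j)) * character m \<theta>)"
    by (simp add: fun_eq_iff partial_character)
  have "integral unit_cube (partial j (character m)) = 0"
    by (intro integral_partial_periodic periodic_partial periodic_character assms character_differentiable)
      (auto simp: p intro!: continuous_intros)
  then show ?thesis using j False by (simp add: p)
qed

text \<open>By orthonormality, the integral of
  \<open>(norm (g \<theta> - P \<theta>))\<^sup>2\<close> is that of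
  \<open>(norm (g \<theta>))\<^sup>2\<close> minus the sum of squared coefficients, and it is
  nonnegative. The cube has volume 1, so the pointwise bound passes to the integral.\<close>

lemma bessel_inequality:
  assumes cont: "continuous_on unit_cube g" and bound: "\<And>\<theta>. \<theta> \<in> unit_cube \<Longrightarrow> norm (g \<theta>) \<le> C"
    and A: "finite A" "A \<subseteq> int_lattice"
  shows "(\<Sum>m\<in>A. (norm (fourier_coeff g m))\<^sup>2) \<le> C\<^sup>2"
proof -
  let ?c = "fourier_coeff g"
  \<comment> \<open>The orthogonal projection of \<open>g\<close> onto the span of the
    \<open>character (- m)\<close>. The minus sign arises because \<open>fourier_coeff\<close> pairs
    \<open>g\<close> with \<open>character m\<close>, the conjugate of
    \<open>character (- m)\<close>.\<close>
  define P where "P \<theta> = (\<Sum>m\<in>A. ?c m * character (- m) \<theta>)" for \<theta>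
  have contP [continuous_intros]: "continuous_on unit_cube P"
    unfolding P_def[abs_def] by (intro continuous_intros)
  have cP: "cnj (P \<theta>) = (\<Sum>m\<in>A. cnj (?c m) * character m \<theta>)" for \<theta>
    by (simp add: P_def cnj_character)
  define S where "S = (\<Sum>m\<in>A. cnj (?c m) * ?c m)"
  have int: "f integrable_on unit_cube" if "continuous_on unit_cube f" for f :: "real ^ 'a \<Rightarrow> complex"
    using that by (rule integrable_continuous)
  have of_real_int: "integral unit_cube (\<lambda>\<theta>. complex_of_real (f \<theta>)) = of_real (integral unit_cube f)"
    if "continuous_on unit_cube f" for f :: "real ^ 'a \<Rightarrow> real"
    using that by (intro integral_unique has_integral_of_real integrable_integral integrable_continuous)
  have gP: "integral unit_cube (\<lambda>\<theta>. g \<theta> * cnj (P \<theta>)) = S"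
  proof -
    have "integral unit_cube (\<lambda>\<theta>. g \<theta> * cnj (P \<theta>))
        = integral unit_cube (\<lambda>\<theta>. \<Sum>m\<in>A. cnj (?c m) * (character m \<theta> * g \<theta>))"
      by (simp add: cP sum_distrib_left mult_ac)
    also have "\<dots> = (\<Sum>m\<in>A. cnj (?c m) * ?c m)"
      unfolding fourier_coeff_def
      by (subst integral_sum) (auto simp: A intro!: int continuous_intros cont)
    finally show ?thesis by (simp add: S_def)
  qed
  have PP: "integral unit_cube (\<lambda>\<theta>. P \<theta> * cnj (P \<theta>)) = S"
  proof -
    have "integral unit_cube (\<lambda>\<theta>. P \<theta> * cnj (P \<theta>))
        = integral unit_cube (\<lambda>\<theta>. \<Sum>m\<in>A. \<Sum>p\<in>A. ?c m * cnj (?c p) * character (p - m) \<theta>)"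
      unfolding cP unfolding P_def sum_product
      by (intro arg_cong2[where f = integral] ext refl sum.cong)
        (simp add: diff_conv_add_uminus character_add mult_ac del: add_uminus_conv_diff)
    also have "\<dots> = (\<Sum>m\<in>A. \<Sum>p\<in>A. ?c m * cnj (?c p) * integral unit_cube (character (p - m)))"
      by (subst integral_sum, simp add: A, intro int continuous_intros,
          intro sum.cong refl, subst integral_sum) (auto simp: A intro!: int continuous_intros)
    also have "\<dots> = (\<Sum>m\<in>A. \<Sum>p\<in>A. if p = m then ?c m * cnj (?c p) else 0)"
    proof (intro sum.cong refl)
      fix m p assume "m \<in> A" "p \<in> A"
      then have "p - m \<in> int_lattice" using A by (auto simp: int_lattice_def subset_iff)
      then show "?c m * cnj (?c p) * integral unit_cube (character (p - m))
          = (if p = m then ?c m * cnj (?c p) else 0)"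
        by (simp add: integral_character)
    qed
    also have "\<dots> = S" by (simp add: S_def A mult.commute)
    finally show ?thesis .
  qed
  \<comment> \<open>The second mixed term follows by conjugating the first, because \<open>S\<close>
    is real.\<close>
  have "integral unit_cube (\<lambda>\<theta>. cnj (g \<theta> * cnj (P \<theta>))) = cnj S"
    using gP integral_cnj[of unit_cube "\<lambda>\<theta>. g \<theta> * cnj (P \<theta>)"] by simp
  also have "cnj S = S" by (simp add: S_def mult.commute)
  finally have Pg: "integral unit_cube (\<lambda>\<theta>. P \<theta> * cnj (g \<theta>)) = S" by (simp add: mult.commute)
  have S: "S = of_real (\<Sum>m\<in>A. (norm (?c m))\<^sup>2)"
    unfolding S_def of_real_sum complex_norm_square by (simp add: mult.commute)
  have "integral unit_cube (\<lambda>\<theta>. of_real ((norm (g \<theta> - P \<theta>))\<^sup>2))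
     = integral unit_cube (\<lambda>\<theta>. (g \<theta> * cnj (g \<theta>) - g \<theta> * cnj (P \<theta>)) - (P \<theta> * cnj (g \<theta>) - P \<theta> * cnj (P \<theta>)))"
    unfolding complex_norm_square by (simp add: algebra_simps)
  also have "\<dots> = integral unit_cube (\<lambda>\<theta>. g \<theta> * cnj (g \<theta>)) - S"
    by (simp add: integral_diff int continuous_intros cont gP PP Pg)
  also have "\<dots> = integral unit_cube (\<lambda>\<theta>. of_real ((norm (g \<theta>))\<^sup>2)) - S"
    unfolding complex_norm_square ..
  finally have "complex_of_real (integral unit_cube (\<lambda>\<theta>. (norm (g \<theta> - P \<theta>))\<^sup>2))
      = of_real (integral unit_cube (\<lambda>\<theta>. (norm (g \<theta>))\<^sup>2)) - S"
    using of_real_int[of "\<lambda>\<theta>. (norm (g \<theta> - P \<theta>))\<^sup>2"] of_real_int[of "\<lambda>\<theta>. (norm (g \<theta>))\<^sup>2"]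
    by (simp add: continuous_intros cont)
  then have "integral unit_cube (\<lambda>\<theta>. (norm (g \<theta> - P \<theta>))\<^sup>2)
      = integral unit_cube (\<lambda>\<theta>. (norm (g \<theta>))\<^sup>2) - (\<Sum>m\<in>A. (norm (?c m))\<^sup>2)"
    unfolding S by (simp only: of_real_diff[symmetric] of_real_eq_iff)
  moreover have "0 \<le> integral unit_cube (\<lambda>\<theta>. (norm (g \<theta> - P \<theta>))\<^sup>2)"
    by (intro integral_nonneg integrable_continuous continuous_intros cont) auto
  moreover have "integral unit_cube (\<lambda>\<theta>. (norm (g \<theta>))\<^sup>2) \<le> integral unit_cube (\<lambda>\<theta>::real^'a. C\<^sup>2)"
    by (intro integral_le integrable_continuous continuous_intros cont power_mono bound) auto
  moreover have "integral unit_cube (\<lambda>\<theta>::real^'a. C\<^sup>2) = C\<^sup>2"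
    by (simp add: content_unit_cube)
  ultimately show ?thesis by linarith
qed

section \<open>Summability over the lattice\<close>

lemma summable_on_Ints:
  fixes \<phi> :: "real \<Rightarrow> real"
  assumes nonneg: "\<And>x. 0 \<le> \<phi> x" and pos: "summable (\<lambda>N. \<phi> (real N))" and neg: "summable (\<lambda>N. \<phi> (- real N))"
  shows "\<phi> summable_on \<int>"
proof -
  have "\<phi> summable_on range real" "\<phi> summable_on range (\<lambda>N. - real N)"
    using pos neg nonneg by (subst summable_on_reindex, auto simp: inj_on_def o_def summable_on_UNIV_nonneg_real_iff)+
  then have "\<phi> summable_on (range real \<union> range (\<lambda>N. - real N))"
    by (rule summable_on_union)
  moreover have "(\<int> :: real set) \<subseteq> range real \<union> range (\<lambda>N. - real N)"
  proof
    fix x :: real assume "x \<in> \<int>"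
    then obtain i where x: "x = of_int i" by (elim Ints_cases)
    show "x \<in> range real \<union> range (\<lambda>N. - real N)"
      unfolding x by (cases i rule: int_cases2) auto
  qed
  ultimately show ?thesis by (rule summable_on_subset)
qed

text \<open>The product has degree \<open>\<kappa>\<close> in \<open>x\<close>, so the terms decay
  like \<open>\<bar>x\<bar> powr (- 2 * \<kappa> / n)\<close>, and this exponent is below -1 exactly
  when \<open>\<kappa> > n / 2\<close>. The power \<open>- 1 / n\<close> prepares a geometric mean
  over \<open>n\<close> coordinates.\<close>

lemma summable_on_Ints_toroidal_weight:
  assumes n: "0 < n" and \<kappa>: "real \<kappa> > n / 2"
  shows "(\<lambda>x::real. (1 + (\<Prod>l<\<kappa>. x + real l)\<^sup>2) powr (- 1 / n)) summable_on \<int>" (is "?\<phi> summable_on _")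
proof -
  let ?a = "- (2 * real \<kappa> / n)"
  \<comment> \<open>The constant comes from replacing \<open>N\<close> by \<open>N / 2\<close>; the
    \<open>+ 1\<close> in the threshold keeps \<open>N\<close> positive, so that powers can be
    rewritten with \<open>powr\<close>.\<close>
  have bound: "norm (?\<phi> x) \<le> 1 / (2 powr ?a) * real N powr ?a"
    if x: "\<bar>x\<bar> = real N" and N: "N \<ge> 2 * \<kappa> + 1" for x N
  proof -
    \<comment> \<open>The factors \<open>x + l\<close> may vanish for \<open>-\<kappa> < x \<le> 0\<close>; only \<open>\<bar>x\<bar> \<ge> 2 \<kappa>\<close> gives \<open>\<bar>x + l\<bar> \<ge> \<bar>x\<bar> / 2\<close>.\<close>
    have "(real N / 2) ^ \<kappa> = (\<Prod>l<\<kappa>. real N / 2)" by simp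
    also have "\<dots> \<le> (\<Prod>l<\<kappa>. \<bar>x + real l\<bar>)"
    proof (intro prod_mono conjI)
      fix l assume "l \<in> {..<\<kappa>}"
      then show "real N / 2 \<le> \<bar>x + real l\<bar>" using x N by (simp add: abs_if split: if_splits)
    qed simp
    also have "\<dots> = \<bar>\<Prod>l<\<kappa>. x + real l\<bar>" by (simp add: abs_prod)
    finally have "((real N / 2) ^ \<kappa>)\<^sup>2 \<le> \<bar>\<Prod>l<\<kappa>. x + real l\<bar>\<^sup>2"
      by (rule power_mono) simp
    then have le: "(real N / 2) ^ (2 * \<kappa>) \<le> 1 + (\<Prod>l<\<kappa>. x + real l)\<^sup>2"
      by (simp add: power_mult mult.commute flip: power_mult)
    have "?\<phi> x \<le> ((real N / 2) ^ (2 * \<kappa>)) powr (- 1 / n)"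
      using N n by (intro powr_mono2' le) auto
    also have "(real N / 2) ^ (2 * \<kappa>) = (real N / 2) powr (real (2 * \<kappa>))"
      using N by (subst powr_realpow) auto
    also have "\<dots> powr (- 1 / n) = (real N / 2) powr ?a"
      by (simp add: powr_powr)
    also have "\<dots> = 1 / (2 powr ?a) * real N powr ?a"
      by (simp add: powr_divide)
    finally show ?thesis by simp
  qed
  have sum: "summable (\<lambda>N. 1 / (2 powr ?a) * real N powr ?a)"
    using n \<kappa> by (intro summable_mult) (simp add: summable_real_powr_iff field_simps)
  have "summable (\<lambda>N. ?\<phi> (real N))" "summable (\<lambda>N. ?\<phi> (- real N))"
    by (rule summable_comparison_test'[OF sum bound]; simp)+
  then show ?thesis by (intro summable_on_Ints) simp_all
qed

text \<open>A finite set of lattice points lies in the box of its coordinate projections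
  \<open>G j\<close>. Over a box the sum factors into one-dimensional sums, each at most the total
  of \<open>\<phi>\<close>.\<close>

lemma summable_on_int_lattice_prod:
  fixes \<phi> :: "real \<Rightarrow> real"
  assumes \<phi>: "\<phi> summable_on \<int>" and nonneg: "\<And>x. 0 \<le> \<phi> x"
  shows "(\<lambda>m::real^'n. \<Prod>j\<in>UNIV. \<phi> (m $ j)) summable_on int_lattice"
proof (rule nonneg_bdd_above_summable_on)
  show "0 \<le> (\<Prod>j\<in>UNIV. \<phi> (m $ j))" for m :: "real ^ 'n" by (intro prod_nonneg nonneg)
  show "bdd_above (sum (\<lambda>m::real^'n. \<Prod>j\<in>UNIV. \<phi> (m $ j)) ` {F. F \<subseteq> int_lattice \<and> finite F})"
  proof (intro bdd_aboveI2)
    fix F :: "(real ^ 'n) set" assume "F \<in> {F. F \<subseteq> int_lattice \<and> finite F}"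
    then have F: "F \<subseteq> int_lattice" "finite F" by auto
    define G where "G j = (\<lambda>m. m $ j) ` F" for j :: 'n
    have "(\<Sum>m\<in>F. \<Prod>j\<in>UNIV. \<phi> (m $ j)) = (\<Sum>g\<in>vec_nth ` F. \<Prod>j\<in>UNIV. \<phi> (g j))"
      by (subst sum.reindex) (auto simp: inj_on_def vec_eq_iff)
    also have "\<dots> \<le> (\<Sum>g\<in>Pi\<^sub>E UNIV G. \<Prod>j\<in>UNIV. \<phi> (g j))"
      using F by (intro sum_mono2 prod_nonneg nonneg finite_PiE) (auto simp: G_def)
    also have "\<dots> = (\<Prod>j\<in>UNIV. \<Sum>x\<in>G j. \<phi> x)"
      by (rule prod_sum_PiE[symmetric]) (use F in \<open>auto simp: G_def\<close>)
    also have "\<dots> \<le> (\<Prod>j\<in>(UNIV::'n set). infsum \<phi> \<int>)"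
      by (intro prod_mono conjI sum_nonneg nonneg finite_sum_le_infsum[OF \<phi>])
        (use F in \<open>auto simp: G_def int_lattice_def\<close>)
    finally show "(\<Sum>m\<in>F. \<Prod>j\<in>UNIV. \<phi> (m $ j)) \<le> (\<Prod>j\<in>(UNIV::'n set). infsum \<phi> \<int>)" .
  qed
qed

text \<open>Up to powers of \<open>h\<close>, these are the squared multipliers of the identity and
  of the operators \<open>toroidal_D\<close> for \<open>axis j \<kappa>\<close>. The summand 1 keeps
  the weight positive where the products vanish.\<close>

definition lattice_weight :: "nat \<Rightarrow> real ^ 'n \<Rightarrow> real" where
  "lattice_weight \<kappa> m = 1 + (\<Sum>j\<in>UNIV. (\<Prod>l<\<kappa>. m $ j + real l)\<^sup>2)"

lemma lattice_weight_ge_1: "1 \<le> lattice_weight \<kappa> m"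
  by (simp add: lattice_weight_def sum_nonneg)

text \<open>
  A lower bound of the weight by a product reduces the summability to dimension one: each of the
  \<open>n\<close> numbers \<open>1 + \<bar>\<Prod>\<^sub>l (m\<^sub>j + l)\<bar>\<^sup>2\<close> is at most \<open>w(m)\<close>, hence so is their geometric mean.
\<close>

lemma summable_on_inverse_lattice_weight:
  assumes \<kappa>: "real \<kappa> > real CARD('n) / 2"
  shows "(\<lambda>m::real^'n. 1 / lattice_weight \<kappa> m) summable_on int_lattice"
proof (rule summable_on_comparison_test)
  let ?n = "real CARD('n)"
  let ?\<phi> = "\<lambda>x::real. (1 + (\<Prod>l<\<kappa>. x + real l)\<^sup>2) powr (- 1 / ?n)"
  have n: "?n > 0" by simp
  show "(\<lambda>m::real^'n. \<Prod>j\<in>UNIV. ?\<phi> (m $ j)) summable_on int_lattice"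
    by (intro summable_on_int_lattice_prod summable_on_Ints_toroidal_weight n \<kappa>) simp
  fix m :: "real ^ 'n"
  have pos: "lattice_weight \<kappa> m > 0" using lattice_weight_ge_1[of \<kappa> m] by linarith
  show "0 \<le> 1 / lattice_weight \<kappa> m" using pos by simp
  have "1 / lattice_weight \<kappa> m = lattice_weight \<kappa> m powr (- 1)"
    using pos by (simp add: powr_minus_divide)
  also have "\<dots> = (lattice_weight \<kappa> m powr (- 1 / ?n)) powr ?n"
    by (simp add: powr_powr)
  also have "\<dots> = (\<Prod>j\<in>(UNIV::'n set). lattice_weight \<kappa> m powr (- 1 / ?n))"
    using pos by (simp add: powr_realpow)
  also have "\<dots> \<le> (\<Prod>j\<in>UNIV. ?\<phi> (m $ j))"
  proof (intro prod_mono conjI powr_mono2')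
    fix j :: 'n
    have "(\<Prod>l<\<kappa>. m $ j + real l)\<^sup>2 \<le> (\<Sum>j\<in>UNIV. (\<Prod>l<\<kappa>. m $ j + real l)\<^sup>2)"
      by (rule member_le_sum) auto
    then show "1 + (\<Prod>l<\<kappa>. m $ j + real l)\<^sup>2 \<le> lattice_weight \<kappa> m"
      by (simp add: lattice_weight_def)
    show "0 < 1 + (\<Prod>l<\<kappa>. m $ j + real l)\<^sup>2"
      by (intro add_pos_nonneg) auto
  qed auto
  finally show "1 / lattice_weight \<kappa> m \<le> (\<Prod>j\<in>UNIV. ?\<phi> (m $ j))" .
qed

section \<open>Boundedness of the quantization\<close>

text \<open>Rows are controlled by Cauchy-Schwarz with weight \<open>u\<close>; since
  \<open>u\<close> depends only on \<open>k - l\<close>, its sum over \<open>k\<close> is at most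
  its total \<open>U\<close>. This gives the norm bound \<open>sqrt (B * U)\<close>. The value 0 off
  \<open>X\<close> is the convention of \<open>l2_on\<close>.\<close>

lemma weighted_kernel_bounded_op_l2:
  fixes X :: "'a::ab_group_add set" and K :: "'a \<Rightarrow> 'a \<Rightarrow> complex" and u :: "'a \<Rightarrow> real"
  assumes diff: "\<And>k l. k \<in> X \<Longrightarrow> l \<in> X \<Longrightarrow> k - l \<in> X"
    and u_pos: "\<And>d. d \<in> X \<Longrightarrow> 0 < u d" and u_sum: "u summable_on X"
    and K: "\<And>k A. k \<in> X \<Longrightarrow> finite A \<Longrightarrow> A \<subseteq> X \<Longrightarrow> (\<Sum>l\<in>A. (norm (K k l))\<^sup>2 / u (k - l)) \<le> B"
    and B: "0 \<le> B"
  shows "bounded_op_l2 X (\<lambda>f k. if k \<in> X then \<Sum>\<^sub>\<infinity>l\<in>X. K k l * f l else 0)" (is "bounded_op_l2 X ?T")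
proof -
  define U where "U = infsum u X"
  define I where "I f k = (\<Sum>\<^sub>\<infinity>l\<in>X. u (k - l) * (norm (f l))\<^sup>2)" for f :: "'a \<Rightarrow> complex" and k
  have U: "sum u A \<le> U" if "finite A" "A \<subseteq> X" for A
    unfolding U_def using that u_sum u_pos by (intro finite_sum_le_infsum) (auto intro: less_imp_le)
  have U0: "0 \<le> U" using U[of "{}"] by simp
  have uU: "u d \<le> U" if "d \<in> X" for d using U[of "{d}"] that by simp
  have nonneg: "0 \<le> u (k - l) * (norm (f l))\<^sup>2" if "k \<in> X" "l \<in> X" for k l and f :: "'a \<Rightarrow> complex"
    using less_imp_le[OF u_pos[OF diff[OF that]]] by simp
  have weighted: "(\<lambda>l. u (k - l) * (norm (f l))\<^sup>2) summable_on X" if f: "f \<in> l2_on X" and k: "k \<in> X" for f k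
  proof (rule summable_on_comparison_test)
    show "(\<lambda>l. U * (norm (f l))\<^sup>2) summable_on X"
      using f by (intro summable_on_cmult_right) (auto simp: l2_on_def)
    fix l assume "l \<in> X"
    then have "u (k - l) \<le> U" "0 < u (k - l)" using k diff uU u_pos by auto
    then show "u (k - l) * (norm (f l))\<^sup>2 \<le> U * (norm (f l))\<^sup>2" "0 \<le> u (k - l) * (norm (f l))\<^sup>2"
      by (simp_all add: mult_right_mono)
  qed
  have row: "sum (\<lambda>l. norm (K k l * f l)) A \<le> sqrt (B * I f k)"
    if f: "f \<in> l2_on X" and k: "k \<in> X" and A: "finite A" "A \<subseteq> X" for f k A
  proof (rule real_le_rsqrt)
    have u: "u (k - l) > 0" if "l \<in> A" for l using that A k u_pos diff by blast
    \<comment> \<open>Multiplying and dividing by \<open>sqrt (u (k - l))\<close> separates the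
      kernel, bounded by \<open>B\<close>, from \<open>I f k\<close>.\<close>
    have "(\<Sum>l\<in>A. norm (K k l * f l))\<^sup>2
        = (\<Sum>l\<in>A. (norm (K k l) / sqrt (u (k - l))) * (sqrt (u (k - l)) * norm (f l)))\<^sup>2"
      by (intro arg_cong[where f = "\<lambda>x. x\<^sup>2"] sum.cong) (use u in \<open>force simp: norm_mult\<close>)+
    also have "\<dots> \<le> (\<Sum>l\<in>A. (norm (K k l) / sqrt (u (k - l)))\<^sup>2) * (\<Sum>l\<in>A. (sqrt (u (k - l)) * norm (f l))\<^sup>2)"
      by (rule Cauchy_Schwarz_ineq_sum)
    also have "\<dots> = (\<Sum>l\<in>A. (norm (K k l))\<^sup>2 / u (k - l)) * (\<Sum>l\<in>A. u (k - l) * (norm (f l))\<^sup>2)"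
      using u by (intro arg_cong2[where f = "(*)"] sum.cong)
        (auto simp: power_divide power_mult_distrib less_imp_le)
    also have "\<dots> \<le> B * I f k"
      unfolding I_def
      by (intro mult_mono K k A B sum_nonneg finite_sum_le_infsum weighted f)
        (use k nonneg A in auto)
    finally show "(\<Sum>l\<in>A. norm (K k l * f l))\<^sup>2 \<le> B * I f k" .
  qed
  have abs: "(\<lambda>l. norm (K k l * f l)) summable_on X" if "f \<in> l2_on X" "k \<in> X" for f k
    by (rule nonneg_bdd_above_summable_on) (auto intro!: bdd_aboveI2 row that)
  have summ: "(\<lambda>l. K k l * f l) summable_on X" if "f \<in> l2_on X" "k \<in> X" for f k
    using abs[OF that] by (rule abs_summable_summable)
  have I0: "0 \<le> I f k" if "k \<in> X" for f k
    unfolding I_def by (intro infsum_nonneg nonneg that)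
  have T_le: "(norm (?T f k))\<^sup>2 \<le> B * I f k" if "f \<in> l2_on X" "k \<in> X" for f k
  proof -
    have "norm (?T f k) \<le> (\<Sum>\<^sub>\<infinity>l\<in>X. norm (K k l * f l))"
      using that norm_infsum_bound[OF abs[OF that]] by simp
    also have "\<dots> \<le> sqrt (B * I f k)"
      by (rule infsum_le_finite_sums[OF abs[OF that]]) (intro row that)
    finally show ?thesis
      using power_mono[of "norm (?T f k)" "sqrt (B * I f k)" 2] B I0[OF that(2), of f] by simp
  qed
  have sum_le: "(\<Sum>k\<in>A. (norm (?T f k))\<^sup>2) \<le> B * U * (\<Sum>\<^sub>\<infinity>l\<in>X. (norm (f l))\<^sup>2)"
    if f: "f \<in> l2_on X" and A: "finite A" "A \<subseteq> X" for f A
  proof -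
    \<comment> \<open>As \<open>A\<close> is finite, additivity of \<open>has_sum\<close> is enough
      to exchange the sums over \<open>k\<close> and \<open>l\<close>.\<close>
    have sumI: "((\<lambda>l. \<Sum>k\<in>A. u (k - l) * (norm (f l))\<^sup>2) has_sum (\<Sum>k\<in>A. I f k)) X"
      using A
    proof (induction A rule: finite_induct)
      case (insert k A)
      then show ?case
        using weighted[OF f, of k] by (simp add: I_def has_sum_add)
    qed simp
    have "(\<Sum>k\<in>A. (norm (?T f k))\<^sup>2) \<le> (\<Sum>k\<in>A. B * I f k)"
      using A by (intro sum_mono T_le f) auto
    also have "\<dots> = B * (\<Sum>k\<in>A. I f k)" by (simp add: sum_distrib_left)
    also have "(\<Sum>k\<in>A. I f k) = (\<Sum>\<^sub>\<infinity>l\<in>X. \<Sum>k\<in>A. u (k - l) * (norm (f l))\<^sup>2)"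
      by (rule infsumI[OF sumI, symmetric])
    also have "\<dots> \<le> (\<Sum>\<^sub>\<infinity>l\<in>X. U * (norm (f l))\<^sup>2)"
    proof (rule infsum_mono)
      show "(\<lambda>l. \<Sum>k\<in>A. u (k - l) * (norm (f l))\<^sup>2) summable_on X"
        by (rule has_sum_imp_summable[OF sumI])
      show "(\<lambda>l. U * (norm (f l))\<^sup>2) summable_on X"
        using f by (intro summable_on_cmult_right) (auto simp: l2_on_def)
      fix l assume l: "l \<in> X"
      \<comment> \<open>For fixed \<open>l\<close> the differences \<open>k - l\<close> are distinct
        points of \<open>X\<close>, so their weights add up to at most \<open>U\<close>.\<close>
      have "(\<Sum>k\<in>A. u (k - l)) = sum u ((\<lambda>k. k - l) ` A)"
        by (subst sum.reindex) (auto simp: inj_on_def)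
      also have "\<dots> \<le> U" using A l diff by (intro U) auto
      finally show "(\<Sum>k\<in>A. u (k - l) * (norm (f l))\<^sup>2) \<le> U * (norm (f l))\<^sup>2"
        by (simp add: mult_right_mono flip: sum_distrib_right)
    qed
    finally show ?thesis using B by (simp add: infsum_cmult_right' mult_left_mono mult.assoc)
  qed
  have T_sum: "(\<lambda>k. (norm (?T f k))\<^sup>2) summable_on X" if f: "f \<in> l2_on X" for f
    by (rule nonneg_bdd_above_summable_on) (auto intro!: bdd_aboveI2 sum_le[OF f] simp del: if_split)
  show ?thesis
    unfolding bounded_op_l2_def
  proof (intro conjI ballI allI exI[of _ "sqrt (B * U)"])
    fix f assume f: "f \<in> l2_on X"
    show "?T f \<in> l2_on X" using T_sum[OF f] by (simp add: l2_on_def)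
    have "(\<Sum>\<^sub>\<infinity>k\<in>X. (norm (?T f k))\<^sup>2) \<le> B * U * (\<Sum>\<^sub>\<infinity>l\<in>X. (norm (f l))\<^sup>2)"
      by (rule infsum_le_finite_sums[OF T_sum[OF f]]) (rule sum_le[OF f])
    then show "l2_norm X (?T f) \<le> sqrt (B * U) * l2_norm X f"
      unfolding l2_norm_def real_sqrt_mult[symmetric] by (rule real_sqrt_le_mono)
    show "?T (\<lambda>x. c * f x) = (\<lambda>x. c * ?T f x)" for c
      by (auto simp: fun_eq_iff infsum_cmult_right'[symmetric] mult_ac)
    show "?T (\<lambda>x. f x + g x) = (\<lambda>x. ?T f x + ?T g x)" if "g \<in> l2_on X" for g
      using summ[OF f] summ[OF that] by (auto simp: fun_eq_iff distrib_left infsum_add)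
  qed
qed

section \<open>Rescaling to the integer lattice and the kernel of \<open>Op\<close>\<close>

lemma mem_scaled_lattice_iff:
  assumes "0 < h"
  shows "x \<in> scaled_lattice h \<longleftrightarrow> (1 / h) *\<^sub>R x \<in> int_lattice"
proof
  assume "(1 / h) *\<^sub>R x \<in> int_lattice"
  then have "h *\<^sub>R ((1 / h) *\<^sub>R x) \<in> scaled_lattice h" unfolding scaled_lattice_def by (rule imageI)
  then show "x \<in> scaled_lattice h" using assms by simp
qed (use assms in \<open>auto simp: scaled_lattice_def\<close>)

lemma scaled_lattice_diff:
  assumes "0 < h" "k \<in> scaled_lattice h" "l \<in> scaled_lattice h"
  shows "k - l \<in> scaled_lattice h"
  using assms by (simp add: mem_scaled_lattice_iff int_lattice_def diff_divide_distrib)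

lemma semiclassical_exp_eq_character:
  "exp (2 * of_real pi * (\<i> / of_real h) * of_real (k \<bullet> \<theta>)) = character ((1 / h) *\<^sub>R k) \<theta>"
  "exp (- 2 * of_real pi * (\<i> / of_real h) * of_real (k \<bullet> \<theta>)) = character (- ((1 / h) *\<^sub>R k)) \<theta>"
  by (simp_all add: character_def cis_conv_exp mult_ac)

text \<open>For \<open>f\<close> in \<open>l1_on\<close> the Weierstrass test, with the symbol
  bounded on the compact cube, makes the series under the integral converge uniformly in
  \<open>\<theta>\<close>. Hence sum and integral commute, and the product of the two characters is
  the one at \<open>(k - l) / h\<close>.\<close>

lemma Op_eq_infsum:
  fixes \<sigma> :: "real ^ 'n \<Rightarrow> real ^ 'n \<Rightarrow> complex"
  assumes cont: "continuous_on UNIV (\<sigma> k)" and f: "f \<in> l1_on (scaled_lattice h)"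
  shows "Op h \<sigma> f k
    = (\<Sum>\<^sub>\<infinity>l\<in>scaled_lattice h. fourier_coeff (\<sigma> k) ((1 / h) *\<^sub>R (k - l)) * f l)"
proof -
  let ?X = "scaled_lattice h :: (real ^ 'n) set"
  define F where "F l \<theta> = character ((1 / h) *\<^sub>R k) \<theta> * \<sigma> k \<theta> * (character (- ((1 / h) *\<^sub>R l)) \<theta> * f l)" for l \<theta>
  have c [continuous_intros]: "continuous_on unit_cube (\<sigma> k)"
    using cont by (rule continuous_on_subset) simp
  have "bounded (\<sigma> k ` unit_cube)"
    by (intro compact_imp_bounded compact_continuous_image c compact_cbox)
  then obtain S where S: "\<And>\<theta>. \<theta> \<in> unit_cube \<Longrightarrow> norm (\<sigma> k \<theta>) \<le> S"
    by (auto simp: bounded_iff)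
  have lim: "uniform_limit unit_cube (\<lambda>A \<theta>. \<Sum>l\<in>A. F l \<theta>) (\<lambda>\<theta>. \<Sum>\<^sub>\<infinity>l\<in>?X. F l \<theta>) (finite_subsets_at_top ?X)"
  proof (rule Weierstrass_m_test_general)
    show "norm (F l \<theta>) \<le> S * norm (f l)" if "\<theta> \<in> unit_cube" for l \<theta>
      using S[OF that] by (simp add: F_def norm_mult mult_right_mono)
    show "(\<lambda>l. S * norm (f l)) summable_on ?X"
      using f by (intro summable_on_cmult_right) (simp add: l1_on_def)
  qed
  have contF: "continuous_on unit_cube (\<lambda>\<theta>. \<Sum>l\<in>A. F l \<theta>)" for A
    unfolding F_def by (intro continuous_intros)
  have partial_sum: "integral unit_cube (\<lambda>\<theta>. \<Sum>l\<in>A. F l \<theta>)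
      = (\<Sum>l\<in>A. fourier_coeff (\<sigma> k) ((1 / h) *\<^sub>R (k - l)) * f l)" if "finite A" for A
  proof -
    have "integral unit_cube (\<lambda>\<theta>. \<Sum>l\<in>A. F l \<theta>) = (\<Sum>l\<in>A. integral unit_cube (F l))"
      using that by (intro integral_sum integrable_continuous) (auto simp: F_def intro!: continuous_intros)
    also have "\<dots> = (\<Sum>l\<in>A. fourier_coeff (\<sigma> k) ((1 / h) *\<^sub>R (k - l)) * f l)"
    proof (rule sum.cong[OF refl])
      fix l
      have "character ((1 / h) *\<^sub>R (k - l)) \<theta>
          = character ((1 / h) *\<^sub>R k) \<theta> * character (- ((1 / h) *\<^sub>R l)) \<theta>" for \<theta>
        by (simp add: scaleR_diff_right flip: character_add)
      then show "integral unit_cube (F l) = fourier_coeff (\<sigma> k) ((1 / h) *\<^sub>R (k - l)) * f l"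
        unfolding F_def fourier_coeff_def integral_mult_left[symmetric] by (simp add: mult_ac)
    qed
    finally show ?thesis .
  qed
  obtain I J where I: "\<And>A. ((\<lambda>\<theta>. \<Sum>l\<in>A. F l \<theta>) has_integral I A) unit_cube"
    and J: "((\<lambda>\<theta>. \<Sum>\<^sub>\<infinity>l\<in>?X. F l \<theta>) has_integral J) unit_cube"
    and IJ: "(I \<longlongrightarrow> J) (finite_subsets_at_top ?X)"
    by (rule uniform_limit_integral_cbox[OF lim contF finite_subsets_at_top_neq_bot]) blast
  \<comment> \<open>\<open>I\<close> is known only as some integral; on finite \<open>A\<close>,
    hence eventually along the filter, it is the partial sum of the kernel series.\<close>
  have "I A = (\<Sum>l\<in>A. fourier_coeff (\<sigma> k) ((1 / h) *\<^sub>R (k - l)) * f l)" if "finite A" for A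
    using integral_unique[OF I[of A]] partial_sum[OF that] by simp
  then have "((\<lambda>l. fourier_coeff (\<sigma> k) ((1 / h) *\<^sub>R (k - l)) * f l) has_sum J) ?X"
    unfolding has_sum_def
    by (intro Lim_transform_eventually[OF IJ] eventually_finite_subsets_at_top_weakI) simp
  then have "(\<Sum>\<^sub>\<infinity>l\<in>?X. fourier_coeff (\<sigma> k) ((1 / h) *\<^sub>R (k - l)) * f l) = J"
    by (rule infsumI)
  also have "J = integral unit_cube (\<lambda>\<theta>. \<Sum>\<^sub>\<infinity>l\<in>?X. F l \<theta>)"
    using J by (rule integral_unique[symmetric])
  \<comment> \<open>Returning to the Lebesgue integral requires continuity of the series, which
    holds as a uniform limit of continuous partial sums.\<close>
  also have "\<dots> = torus_integral (\<lambda>\<theta>. \<Sum>\<^sub>\<infinity>l\<in>?X. F l \<theta>)"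
    using uniform_limit_theorem[OF always_eventually lim] contF
    by (intro torus_integral_eq_integral[symmetric]) simp
  also have "\<dots> = Op h \<sigma> f k"
    unfolding Op_def sc_fourier_def semiclassical_exp_eq_character F_def infsum_cmult_right' ..
  finally show ?thesis ..
qed

text \<open>Bessel's inequality is applied to \<open>g\<close> itself, as
  \<open>toroidal_D h 0 g\<close>, and to \<open>toroidal_D h (axis j \<kappa>) g\<close> for each
  \<open>j\<close>. Dividing out the square of \<open>h ^ \<kappa>\<close> yields the term
  \<open>CARD('n) / h ^ (2 * \<kappa>)\<close>.\<close>

lemma weighted_fourier_coeff_bound:
  fixes g :: "(real, 'n::{finite,linorder}) vec \<Rightarrow> complex"
  assumes h: "0 < h" and g: "torus_Ck \<kappa> g"
    and C: "\<And>\<alpha> \<theta>. mi_order \<alpha> \<le> \<kappa> \<Longrightarrow> norm (toroidal_D h \<alpha> g \<theta>) \<le> C"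
    and A: "finite A" "A \<subseteq> int_lattice"
  shows "(\<Sum>m\<in>A. lattice_weight \<kappa> m * (norm (fourier_coeff g m))\<^sup>2)
    \<le> (1 + real CARD('n) / h ^ (2 * \<kappa>)) * C\<^sup>2"
proof -
  let ?c = "\<lambda>m. (norm (fourier_coeff g m))\<^sup>2"
  have "toroidal_D h 0 g \<theta> = g \<theta>" for \<theta>
    by (simp add: toroidal_D_def mi_order_def map_replicate_const)
  then have "norm (g \<theta>) \<le> C" for \<theta>
    using C[of 0 \<theta>] by (simp add: mi_order_def)
  moreover have "continuous_on unit_cube g"
    using g Ck_continuous continuous_on_subset unfolding torus_Ck_def by blast
  ultimately have zeroth: "(\<Sum>m\<in>A. ?c m) \<le> C\<^sup>2"
    by (intro bessel_inequality A)
  have jth: "(\<Sum>m\<in>A. (\<Prod>l<\<kappa>. m $ j + real l)\<^sup>2 * ?c m) \<le> C\<^sup>2 / h ^ (2 * \<kappa>)" for j :: 'n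
  proof -
    define \<alpha> where "\<alpha> = (axis j \<kappa> :: (nat, 'n) vec)"
    have ord: "mi_order \<alpha> = \<kappa>" by (simp add: mi_order_def \<alpha>_def axis_def)
    have D: "(norm (fourier_coeff (toroidal_D h \<alpha> g) m))\<^sup>2
        = h ^ (2 * \<kappa>) * ((\<Prod>l<\<kappa>. m $ j + real l)\<^sup>2 * ?c m)" if "m \<in> int_lattice" for m
    proof -
      \<comment> \<open>In directions \<open>i \<noteq> j\<close> the entry
        \<open>\<alpha> $ i\<close> is 0 and the inner product is empty.\<close>
      have "(\<Prod>i\<in>UNIV. \<Prod>l<\<alpha> $ i. - of_real (m $ i + real l))
          = (\<Prod>i\<in>UNIV. if i = j then \<Prod>l<\<kappa>. - complex_of_real (m $ j + real l) else 1)"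
        by (intro prod.cong) (auto simp: \<alpha>_def axis_def)
      then have "fourier_coeff (toroidal_D h \<alpha> g) m
          = of_real (h ^ \<kappa>) * (\<Prod>l<\<kappa>. - of_real (m $ j + real l)) * fourier_coeff g m"
        using fourier_coeff_toroidal_D(2)[of \<alpha> g m h] g that ord by simp
      then have "norm (fourier_coeff (toroidal_D h \<alpha> g) m)
          = h ^ \<kappa> * \<bar>\<Prod>l<\<kappa>. m $ j + real l\<bar> * norm (fourier_coeff g m)"
        using h by (simp only: norm_mult norm_of_real prod_norm[symmetric] norm_minus_cancel abs_prod) simp
      then show ?thesis
        by (simp add: power_mult_distrib power_even_eq)
    qed
    have "h ^ (2 * \<kappa>) * (\<Sum>m\<in>A. (\<Prod>l<\<kappa>. m $ j + real l)\<^sup>2 * ?c m)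
        = (\<Sum>m\<in>A. (norm (fourier_coeff (toroidal_D h \<alpha> g) m))\<^sup>2)"
      unfolding sum_distrib_left using A by (intro sum.cong refl D[symmetric]) auto
    also have "\<dots> \<le> C\<^sup>2"
    proof (intro bessel_inequality A)
      show "continuous_on unit_cube (toroidal_D h \<alpha> g)"
        by (rule continuous_on_subset[OF fourier_coeff_toroidal_D(1)]) (use g ord in auto)
    qed (simp add: C ord)
    finally show ?thesis using h by (simp add: field_simps)
  qed
  have "(\<Sum>m\<in>A. lattice_weight \<kappa> m * ?c m)
      = (\<Sum>m\<in>A. ?c m) + (\<Sum>j\<in>UNIV. \<Sum>m\<in>A. (\<Prod>l<\<kappa>. m $ j + real l)\<^sup>2 * ?c m)"
    by (subst sum.swap) (simp add: lattice_weight_def distrib_right sum.distrib sum_distrib_right)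
  also have "\<dots> \<le> C\<^sup>2 + (\<Sum>j\<in>(UNIV::'n set). C\<^sup>2 / h ^ (2 * \<kappa>))"
    by (intro add_mono zeroth sum_mono jth)
  also have "\<dots> = (1 + real CARD('n) / h ^ (2 * \<kappa>)) * C\<^sup>2"
    by (simp add: distrib_right)
  finally show ?thesis .
qed

theorem theorem6p2:
  fixes h C :: real
    and \<kappa> :: nat
    and \<sigma> :: "(real, 'n::{finite,linorder}) vec \<Rightarrow> (real, 'n) vec \<Rightarrow> complex"
  assumes "0 < h" and "h \<le> 1"
    and "real \<kappa> > real CARD('n) / 2"
    and "\<And>k. k \<in> scaled_lattice h \<Longrightarrow> torus_Ck \<kappa> (\<sigma> k)"
    and "\<And>\<alpha> k \<theta>. mi_order \<alpha> \<le> \<kappa> \<Longrightarrow> k \<in> scaled_lattice h \<Longrightarrow>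
           norm (toroidal_D h \<alpha> (\<sigma> k) \<theta>) \<le> C"
  shows "extends_to_bounded_op_l2 h \<sigma>"
proof -
  let ?X = "scaled_lattice h :: (real, 'n) vec set"
  let ?K = "\<lambda>k l. fourier_coeff (\<sigma> k) ((1 / h) *\<^sub>R (k - l))"
  \<comment> \<open>With \<open>u\<close> the reciprocal of the weight, dividing by
    \<open>u (k - l)\<close> and substituting \<open>m = (k - l) / h\<close> turns a row sum into
    the weighted coefficient sum, whose bound is uniform in \<open>k\<close> because
    \<open>C\<close> is.\<close>
  let ?u = "\<lambda>d :: (real, 'n) vec. 1 / lattice_weight \<kappa> ((1 / h) *\<^sub>R d)"
  note h = \<open>0 < h\<close>
  have "bounded_op_l2 ?X (\<lambda>f k. if k \<in> ?X then \<Sum>\<^sub>\<infinity>l\<in>?X. ?K k l * f l else 0)"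
  proof (rule weighted_kernel_bounded_op_l2)
    show "k - l \<in> ?X" if "k \<in> ?X" "l \<in> ?X" for k l
      using scaled_lattice_diff[OF h] that .
    show "0 < ?u d" for d using lattice_weight_ge_1[of \<kappa> "(1 / h) *\<^sub>R d"] by simp
    have "(?u \<circ> (\<lambda>m. h *\<^sub>R m)) summable_on int_lattice"
      using summable_on_inverse_lattice_weight[OF assms(3)] h by (simp add: o_def)
    then show "?u summable_on ?X"
      unfolding scaled_lattice_def using h by (subst summable_on_reindex) (auto simp: inj_on_def)
    show "0 \<le> (1 + real CARD('n) / h ^ (2 * \<kappa>)) * C\<^sup>2" using h by simp
    fix k A assume k: "k \<in> ?X" and A: "finite A" "A \<subseteq> ?X"
    let ?\<phi> = "\<lambda>l. (1 / h) *\<^sub>R (k - l)"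
    have inj: "inj_on ?\<phi> A" using h by (auto simp: inj_on_def)
    have "(\<Sum>l\<in>A. (norm (?K k l))\<^sup>2 / ?u (k - l))
        = (\<Sum>m\<in>?\<phi> ` A. lattice_weight \<kappa> m * (norm (fourier_coeff (\<sigma> k) m))\<^sup>2)"
      by (subst sum.reindex[OF inj]) (simp add: mult.commute)
    also have "\<dots> \<le> (1 + real CARD('n) / h ^ (2 * \<kappa>)) * C\<^sup>2"
    proof (rule weighted_fourier_coeff_bound[OF h assms(4)[OF k]])
      have "k - l \<in> ?X" if "l \<in> A" for l using scaled_lattice_diff[OF h k] A that by blast
      then show "?\<phi> ` A \<subseteq> int_lattice" using mem_scaled_lattice_iff[OF h] by blast
    qed (use A k assms(5) in auto)
    finally show "(\<Sum>l\<in>A. (norm (?K k l))\<^sup>2 / ?u (k - l)) \<le> (1 + real CARD('n) / h ^ (2 * \<kappa>)) * C\<^sup>2" .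
  qed
  moreover have "(\<Sum>\<^sub>\<infinity>l\<in>?X. ?K k l * f l) = Op h \<sigma> f k" if "f \<in> l1_on ?X" "k \<in> ?X" for f k
    using assms(4)[OF that(2)] that(1) Ck_continuous by (intro Op_eq_infsum[symmetric]) (auto simp: torus_Ck_def)
  ultimately show ?thesis
    unfolding extends_to_bounded_op_l2_def
    by (intro exI[of _ "\<lambda>f k. if k \<in> ?X then \<Sum>\<^sub>\<infinity>l\<in>?X. ?K k l * f l else 0"]) simp
qed

end
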